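(* Let $\alpha\in(0,2)$, $N=2$, let $\mathcal{N}$ be a norm on $\mathbb{R}^2$ and let $\lambda_\alpha>0$ be the constant defined by $\lambda_\alpha^{-1}=\int_0^{+\infty}\frac{dt}{1+t^{2+\alpha}}$. Then $$\Phi_\alpha(p_1,p_2)=\lambda_\alpha\,\mathcal{N}(-p_2,p_1).$$
   Context: $\Phi_\alpha$ is the $1$-homogeneous function on $\mathbb{R}^2$ given, for $p=(p_1,p_2)\in\mathbb{R}^2\setminus\{0\}$, by $\Phi_\alpha(p)=\Big(2\int_{p^\perp}\frac{d\mathcal{H}^{1}(x)}{1+\mathcal{N}(x)^{2+\alpha}}\Big)^{-1}|p|$, where $p^\perp=\{x\in\mathbb{R}^2:\langle x,p\rangle=0\}$, $\mathcal{H}^1$ is the one-dimensional Hausdorff measure and $|\cdot|$ is the Euclidean norm; $\Phi_\alpha(0)=0$.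
   Formalization: The constant is corrected: with the given definitions of Φ_α and λ_α the identity reads Φ_α(p_1,p_2) = (λ_α/4) N(-p_2,p_1), since the integral over the full line p^⊥ and the prefactor 2 each contribute a factor 2; the identity without 1/4 fails for every p ≠ 0. *)

theory Defs
  imports "HOL-Analysis.Analysis"
begin

definition is_norm :: "('a::real_vector \<Rightarrow> real) \<Rightarrow> bool" where
  "is_norm N \<longleftrightarrow>
     (\<forall>x. 0 \<le> N x) \<and>
     (\<forall>x. N x = 0 \<longleftrightarrow> x = 0) \<and>
     (\<forall>c x. N (c *\<^sub>R x) = \<bar>c\<bar> * N x) \<and>
     (\<forall>x y. N (x + y) \<le> N x + N y)"

text \<open>
  The one-dimensional Hausdorff measure, normalised so that it is length on lines.
  The covering sets are required to be bounded because the library's \<^const>\<open>diameter\<close>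
  has no meaningful value on unbounded sets.
\<close>

definition hausdorff1_pre :: "real \<Rightarrow> 'a::metric_space set \<Rightarrow> ennreal" where
  "hausdorff1_pre \<delta> A =
     (INF C \<in> {C :: nat \<Rightarrow> 'a set. A \<subseteq> (\<Union>i. C i) \<and> (\<forall>i. bounded (C i) \<and> diameter (C i) \<le> \<delta>)}.
        \<Sum>i. ennreal (diameter (C i)))"

definition hausdorff1_outer :: "'a::metric_space set \<Rightarrow> ennreal" where
  "hausdorff1_outer A = (SUP \<delta>\<in>{0<..}. hausdorff1_pre \<delta> A)"

definition hausdorff1 :: "'a::metric_space measure" where
  "hausdorff1 = measure_of UNIV (sets borel) hausdorff1_outer"

definition Phi :: "real \<Rightarrow> (real^2 \<Rightarrow> real) \<Rightarrow> real^2 \<Rightarrow> real" where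
  "Phi \<alpha> N p =
     (if p = 0 then 0
      else inverse (2 * (LINT x:{x. x \<bullet> p = 0}|hausdorff1. 1 / (1 + N x powr (2 + \<alpha>)))) * norm p)"

text \<open>
  The line orthogonal to \<open>p = (p1, p2) \<noteq> 0\<close> is the set of all \<open>t (-p2, p1) / |p|\<close>. With
  \<open>c = N (-p2, p1) / |p|\<close>, the integral in \<^const>\<open>Phi\<close> runs over both half-lines and equals
  \<open>2 / (c \<lambda>)\<close> for the constant \<open>\<lambda>\<close> below. Together with the prefactor 2 this gives
  \<open>Phi \<alpha> N p = (\<lambda> / 4) N (-p2, p1)\<close>, so the factor 1/4 cannot be dropped under these
  normalisations.
\<close>

definition lambda_const :: "real \<Rightarrow> real" where
  "lambda_const \<alpha> = inverse (LINT t:{0..}|lborel. 1 / (1 + t powr (2 + \<alpha>)))"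

end

theory Submission
  imports Defs "HOL-Probability.Sinc_Integral"
begin

text \<open>
  The one-dimensional Hausdorff outer measure is additive on sets at positive distance, so by
  Caratheodory's criterion it is a measure on the Borel sets, and on an isometric copy of
  \<open>\<real>\<close> it is Lebesgue measure. With \<open>e\<close> the unit vector \<open>(-p2, p1) / |p|\<close>, the
  integral over the line orthogonal to \<open>p\<close> is therefore the integral of
  \<open>1 / (1 + (|t| N e)\<^sup>2\<^sup>+\<^sup>\<alpha>)\<close> over \<open>t \<in> \<real>\<close>, and scaling
  \<open>t\<close> by \<open>N e\<close> gives \<open>2 / (N e \<lambda>\<^sub>\<alpha>)\<close>.
\<close>


section \<open>Premeasures and the outer measure\<close>

lemma hausdorff1_pre_le:
  assumes "A \<subseteq> (\<Union>i. C i)" "\<And>i. bounded (C i)" "\<And>i. diameter (C i) \<le> \<delta>"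
  shows "hausdorff1_pre \<delta> A \<le> (\<Sum>i. ennreal (diameter (C i)))"
  unfolding hausdorff1_pre_def using assms by (intro INF_lower) auto

lemma hausdorff1_pre_mono: "A \<subseteq> B \<Longrightarrow> hausdorff1_pre \<delta> A \<le> hausdorff1_pre \<delta> B"
  unfolding hausdorff1_pre_def by (intro INF_superset_mono) auto

lemma hausdorff1_pre_antimono: "\<delta> \<le> \<epsilon> \<Longrightarrow> hausdorff1_pre \<epsilon> A \<le> hausdorff1_pre \<delta> A"
  unfolding hausdorff1_pre_def by (intro INF_superset_mono) (auto intro: order_trans)

lemma hausdorff1_pre_empty: "0 < \<delta> \<Longrightarrow> hausdorff1_pre \<delta> {} = 0"
  using hausdorff1_pre_le[of "{}" "\<lambda>_. {}" \<delta>] by simp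

lemma hausdorff1_pre_le_outer: "0 < \<delta> \<Longrightarrow> hausdorff1_pre \<delta> A \<le> hausdorff1_outer A"
  unfolding hausdorff1_outer_def by (intro SUP_upper) auto

lemma hausdorff1_outer_mono: "A \<subseteq> B \<Longrightarrow> hausdorff1_outer A \<le> hausdorff1_outer B"
  unfolding hausdorff1_outer_def by (intro SUP_mono) (auto intro: hausdorff1_pre_mono)

lemma hausdorff1_outer_empty: "hausdorff1_outer {} = 0"
  unfolding hausdorff1_outer_def by (auto simp: hausdorff1_pre_empty intro!: antisym SUP_least)

text \<open>Each \<open>A n\<close> gets an admissible cover that is optimal up to
  \<open>e / 2 ^ (n + 1)\<close>. The double sequence of covering sets is enumerated by
  \<open>prod_decode\<close>, and the errors add up to \<open>e\<close>.\<close>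

lemma hausdorff1_pre_UN_le:
  fixes A :: "nat \<Rightarrow> 'a::metric_space set"
  shows "hausdorff1_pre \<delta> (\<Union>n. A n) \<le> (\<Sum>n. hausdorff1_pre \<delta> (A n))"
proof (rule ennreal_le_epsilon)
  fix e :: real
  assume "0 < e" and fin: "(\<Sum>n. hausdorff1_pre \<delta> (A n)) < top"
  \<comment> \<open>Finiteness of the sum makes every term finite, so adding a positive error gives
    a strict inequality and the infimum yields an actual cover.\<close>
  then have close: "hausdorff1_pre \<delta> (A n) < hausdorff1_pre \<delta> (A n) + e * (1/2) ^ Suc n" for n
    by (auto simp: less_top dest!: ennreal_suminf_lessD)
  have "\<exists>C. A n \<subseteq> (\<Union>i. C i) \<and> (\<forall>i. bounded (C i) \<and> diameter (C i) \<le> \<delta>) \<and>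
      (\<Sum>i. ennreal (diameter (C i))) \<le> hausdorff1_pre \<delta> (A n) + e * (1/2) ^ Suc n" for n
    using close[of n] unfolding hausdorff1_pre_def[of \<delta> "A n"] INF_less_iff
    by (auto intro: less_imp_le)
  then obtain C where C: "\<And>n. A n \<subseteq> (\<Union>i. C n i)"
    "\<And>n i. bounded (C n i)" "\<And>n i. diameter (C n i) \<le> \<delta>"
    "\<And>n. (\<Sum>i. ennreal (diameter (C n i))) \<le> hausdorff1_pre \<delta> (A n) + e * (1/2) ^ Suc n"
    by metis
  have "(\<Union>n. A n) \<subseteq> (\<Union>k. case_prod C (prod_decode k))"
    using C(1) by (auto simp: subset_eq) (metis prod.case prod_encode_inverse)
  then have "hausdorff1_pre \<delta> (\<Union>n. A n) \<le> (\<Sum>k. ennreal (diameter (case_prod C (prod_decode k))))"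
    using C(2,3) by (intro hausdorff1_pre_le) (auto split: prod.split)
  also have "\<dots> = (\<Sum>n. \<Sum>i. ennreal (diameter (C n i)))"
    by (rule suminf_ennreal_2dimen) simp
  also have "\<dots> \<le> (\<Sum>n. hausdorff1_pre \<delta> (A n) + e * (1/2) ^ Suc n)"
    by (intro suminf_le C(4)) auto
  also have "\<dots> = (\<Sum>n. hausdorff1_pre \<delta> (A n)) + (\<Sum>n. ennreal e * ennreal ((1/2) ^ Suc n))"
    using \<open>0 < e\<close> by (subst suminf_add[symmetric])
      (auto simp del: ennreal_suminf_cmult simp add: ennreal_mult[symmetric])
  also have "\<dots> = (\<Sum>n. hausdorff1_pre \<delta> (A n)) + e"
    unfolding ennreal_suminf_cmult
    by (subst suminf_ennreal_eq[OF zero_le_power power_half_series]) auto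
  finally show "hausdorff1_pre \<delta> (\<Union>n. A n) \<le> (\<Sum>n. hausdorff1_pre \<delta> (A n)) + e" .
qed

lemma hausdorff1_outer_UN_le:
  fixes A :: "nat \<Rightarrow> 'a::metric_space set"
  shows "hausdorff1_outer (\<Union>n. A n) \<le> (\<Sum>n. hausdorff1_outer (A n))"
  unfolding hausdorff1_outer_def[of "\<Union>n. A n"]
proof (rule SUP_least)
  fix \<delta> :: real assume "\<delta> \<in> {0<..}"
  then show "hausdorff1_pre \<delta> (\<Union>n. A n) \<le> (\<Sum>n. hausdorff1_outer (A n))"
    by (intro order_trans[OF hausdorff1_pre_UN_le] suminf_le hausdorff1_pre_le_outer) auto
qed

lemma outer_measure_space_hausdorff1_outer:
  "outer_measure_space UNIV (hausdorff1_outer :: 'a::metric_space set \<Rightarrow> ennreal)"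
  unfolding outer_measure_space_def positive_def increasing_def countably_subadditive_def
  by (auto simp: hausdorff1_outer_empty intro: hausdorff1_outer_mono hausdorff1_outer_UN_le)

text \<open>A set of diameter below \<epsilon> cannot meet both \<open>A\<close> and
  \<open>B\<close>. Hence a fine cover of the union splits into a cover of \<open>A\<close> and one
  of \<open>B\<close> at no extra cost, the empty traces having diameter 0.\<close>

lemma hausdorff1_outer_Un_separated:
  fixes A B :: "'a::metric_space set"
  assumes "0 < \<epsilon>" and sep: "\<And>x y. x \<in> A \<Longrightarrow> y \<in> B \<Longrightarrow> \<epsilon> \<le> dist x y"
  shows "hausdorff1_outer A + hausdorff1_outer B \<le> hausdorff1_outer (A \<union> B)"
proof -
  have pre: "hausdorff1_pre \<delta> A + hausdorff1_pre \<delta> B \<le> hausdorff1_pre \<delta> (A \<union> B)" if "\<delta> < \<epsilon>" for \<delta>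
    unfolding hausdorff1_pre_def[of \<delta> "A \<union> B"]
  proof (rule INF_greatest, clarify)
    fix C :: "nat \<Rightarrow> 'a set"
    assume cover: "A \<union> B \<subseteq> (\<Union>i. C i)" and "\<forall>i. bounded (C i) \<and> diameter (C i) \<le> \<delta>"
    then have bdd: "bounded (C i)" and diam: "diameter (C i) \<le> \<delta>" for i
      by auto
    have split: "ennreal (diameter (C i \<inter> A)) + ennreal (diameter (C i \<inter> B)) \<le> ennreal (diameter (C i))" for i
    proof -
      have "C i \<inter> A = {} \<or> C i \<inter> B = {}"
        using sep diameter_bounded_bound[OF bdd] diam[of i] \<open>\<delta> < \<epsilon>\<close> by fastforce
      then show ?thesis
        using diameter_subset[OF _ bdd[of i]] by (auto intro!: ennreal_leI)
    qed
    have le: "diameter (C i \<inter> X) \<le> \<delta>" for i X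
      using diameter_subset[OF _ bdd, of "C i \<inter> X" i] diam[of i] by auto
    have "hausdorff1_pre \<delta> A + hausdorff1_pre \<delta> B
        \<le> (\<Sum>i. ennreal (diameter (C i \<inter> A))) + (\<Sum>i. ennreal (diameter (C i \<inter> B)))"
      using cover by (intro add_mono hausdorff1_pre_le le) (auto intro: bounded_subset[OF bdd])
    also have "\<dots> = (\<Sum>i. ennreal (diameter (C i \<inter> A)) + ennreal (diameter (C i \<inter> B)))"
      by (rule suminf_add) auto
    also have "\<dots> \<le> (\<Sum>i. ennreal (diameter (C i)))"
      by (intro suminf_le split) auto
    finally show "hausdorff1_pre \<delta> A + hausdorff1_pre \<delta> B \<le> (\<Sum>i. ennreal (diameter (C i)))" .
  qed
  \<comment> \<open>The premeasures grow as the mesh shrinks, so two meshes are dominated by their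
    minimum and the sum of the suprema is a single supremum.\<close>
  have "hausdorff1_outer A + hausdorff1_outer B
      = (SUP \<delta>\<in>{0<..}. hausdorff1_pre \<delta> A + hausdorff1_pre \<delta> B)"
    unfolding hausdorff1_outer_def
  proof (rule SUP_add_directed_ennreal[symmetric])
    fix i j :: real assume "i \<in> {0<..}" "j \<in> {0<..}"
    then show "\<exists>k\<in>{0<..}. hausdorff1_pre i A + hausdorff1_pre j B \<le> hausdorff1_pre k A + hausdorff1_pre k B"
      by (intro bexI[of _ "min i j"] add_mono hausdorff1_pre_antimono) auto
  qed
  also have "\<dots> \<le> hausdorff1_outer (A \<union> B)"
  proof (rule SUP_least)
    fix \<delta> :: real assume "\<delta> \<in> {0<..}"
    \<comment> \<open>Refining the mesh only increases the left side, and a mesh below \<epsilon> is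
      what \<open>pre\<close> requires.\<close>
    define \<eta> where "\<eta> = min \<delta> (\<epsilon> / 2)"
    have \<eta>: "0 < \<eta>" "\<eta> \<le> \<delta>" "\<eta> < \<epsilon>"
      using \<open>\<delta> \<in> {0<..}\<close> \<open>0 < \<epsilon>\<close> by (auto simp: \<eta>_def)
    have "hausdorff1_pre \<delta> A + hausdorff1_pre \<delta> B \<le> hausdorff1_pre \<eta> A + hausdorff1_pre \<eta> B"
      by (intro add_mono hausdorff1_pre_antimono \<eta>)
    also have "\<dots> \<le> hausdorff1_pre \<eta> (A \<union> B)"
      by (rule pre[OF \<eta>(3)])
    also have "\<dots> \<le> hausdorff1_outer (A \<union> B)"
      by (rule hausdorff1_pre_le_outer[OF \<eta>(1)])
    finally show "hausdorff1_pre \<delta> A + hausdorff1_pre \<delta> B \<le> hausdorff1_outer (A \<union> B)" .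
  qed
  finally show ?thesis .
qed

section \<open>Caratheodory's criterion for metric outer measures\<close>

text \<open>\<open>A - F\<close> is exhausted by its points at distance at least
  \<open>(1/2) ^ n\<close> from \<open>F\<close>. What is missed lies in dyadic distance rings,
  whose measures form a convergent series, so the error is a small tail.\<close>

lemma closed_in_lambda_system:
  fixes \<mu> :: "'a::metric_space set \<Rightarrow> ennreal"
  assumes outer: "outer_measure_space UNIV \<mu>"
    and metric: "\<And>A B \<epsilon>. 0 < \<epsilon> \<Longrightarrow> (\<And>x y. x \<in> A \<Longrightarrow> y \<in> B \<Longrightarrow> \<epsilon> \<le> dist x y) \<Longrightarrow> \<mu> A + \<mu> B \<le> \<mu> (A \<union> B)"
    and "closed F"
  shows "F \<in> lambda_system UNIV UNIV \<mu>"
proof (cases "F = {}")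
  case True
  then show ?thesis
    using outer by (simp add: lambda_system_def outer_measure_space_def positive_def)
next
  case False
  have empty: "\<mu> {} = 0" and mono: "\<And>A B. A \<subseteq> B \<Longrightarrow> \<mu> A \<le> \<mu> B"
    and csub: "\<And>A. disjoint_family A \<Longrightarrow> \<mu> (\<Union>i. A i) \<le> (\<Sum>i. \<mu> (A i))"
    using outer by (auto simp: outer_measure_space_def positive_def increasing_def countably_subadditive_def)
  have "subadditive UNIV \<mu>"
    using outer ring_of_sets.countably_subadditive_subadditive[OF ring_of_sets_Pow[of UNIV], of \<mu>]
    by (simp add: outer_measure_space_def)
  then have sub: "\<mu> (A \<union> B) \<le> \<mu> A + \<mu> B" if "A \<inter> B = {}" for A B
    using that by (rule subadditiveD) auto
  define d where "d x = infdist x F" for x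
  have d_nonneg: "0 \<le> d x" for x
    by (simp add: d_def infdist_nonneg)
  have d_lipschitz: "d x - d y \<le> dist x y" for x y
    using infdist_triangle[of x F y] by (simp add: d_def)
  have F_iff: "x \<in> F \<longleftrightarrow> d x = 0" for x
    using in_closed_iff_infdist_zero[OF \<open>closed F\<close> False] by (simp add: d_def)
  have "\<mu> (A \<inter> F) + \<mu> (A - F) \<le> \<mu> A" for A
  \<comment> \<open>This reduces the claim to finite \<open>\<mu> A\<close>, which is what bounds
    the sum over the rings.\<close>
  proof (rule ennreal_le_epsilon)
    fix e :: real assume fin: "\<mu> A < top" and "0 < e"
    define T where "T n = {x \<in> A. (1/2) ^ n \<le> d x}" for n :: nat
    define R where "R k = {x \<in> A. (1/2) ^ Suc k \<le> d x \<and> d x < (1/2) ^ k}" for k :: nat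
    text \<open>Rings whose indices differ by at least two have positive distance, so \<open>\<mu>\<close> is
      superadditive on the even rings and on the odd rings.\<close>
    have alternate: "(\<Sum>k<n. \<mu> (R (2 * k + p))) \<le> \<mu> (\<Union>k<n. R (2 * k + p))" for n p
    proof (induction n)
      case (Suc n)
      have sep: "\<mu> (\<Union>k<n. R (2 * k + p)) + \<mu> (R (2 * n + p)) \<le> \<mu> ((\<Union>k<n. R (2 * k + p)) \<union> R (2 * n + p))"
      proof (rule metric[where \<epsilon> = "(1/2) ^ (2 * n + p)"])
        fix x y assume "x \<in> (\<Union>k<n. R (2 * k + p))" and y: "y \<in> R (2 * n + p)"
        then obtain k where k: "k < n" "x \<in> R (2 * k + p)"
          by auto
        \<comment> \<open>Since \<open>k < n\<close>, the exponent on the right is at most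
          \<open>2 * n + p\<close>. The skipped ring thus gives a factor 2 between the lower bound
          for \<open>d x\<close> and the upper bound for \<open>d y\<close>, and one copy of it
          remains as the distance.\<close>
        have "(1/2) ^ (2 * n + p) \<le> ((1/2) ^ Suc (Suc (2 * k + p)) :: real)"
          using k(1) by (intro power_decreasing) auto
        then have "2 * (1/2) ^ (2 * n + p) \<le> d x"
          using k(2) by (simp add: R_def)
        moreover have "d y < (1/2) ^ (2 * n + p)"
          using y by (simp add: R_def)
        ultimately show "(1/2) ^ (2 * n + p) \<le> dist x y"
          using d_lipschitz[of x y] by linarith
      qed simp
      show ?case
        using order_trans[OF add_right_mono[OF Suc.IH] sep] by (simp add: lessThan_Suc ac_simps Un_commute)
    qed (simp add: empty)
    have alternate_le: "(\<Sum>k<n. \<mu> (R (2 * k + p))) \<le> \<mu> A" for n p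
      by (rule order_trans[OF alternate mono]) (auto simp: R_def)
    \<comment> \<open>Even rings (\<open>p = 0\<close>) and odd rings (\<open>p = 1\<close>) each
      contribute at most \<open>\<mu> A\<close>.\<close>
    have "(\<Sum>k<n. \<mu> (R k)) \<le> \<mu> A + \<mu> A" for n
    proof -
      have "(\<Sum>k<n. \<mu> (R k)) \<le> (\<Sum>k<2*n. \<mu> (R k))"
        by (intro sum_mono2) auto
      also have "\<dots> = (\<Sum>k<n. \<mu> (R (2 * k + 0))) + (\<Sum>k<n. \<mu> (R (2 * k + 1)))"
        by (induction n) (auto simp: ac_simps)
      also have "\<dots> \<le> \<mu> A + \<mu> A"
        by (intro add_mono alternate_le)
      finally show ?thesis .
    qed
    then have "(\<Sum>k. \<mu> (R k)) \<le> \<mu> A + \<mu> A"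
      by (intro suminf_le_const summableI)
    then have fin_sum: "(\<Sum>k. \<mu> (R k)) < top"
      using fin by (auto intro: le_less_trans)
    \<comment> \<open>The finite values are moved to the reals, where summability provides an index
      \<open>n\<close> with tail below \<open>e\<close>.\<close>
    define r where "r k = enn2real (\<mu> (R k))" for k
    have r: "\<mu> (R k) = ennreal (r k)" "0 \<le> r k" for k
      using ennreal_suminf_lessD[OF fin_sum, of k] by (auto simp: r_def)
    have "summable r"
      using fin_sum by (intro summable_suminf_not_top) (auto simp: r)
    then obtain n where n: "norm (\<Sum>k. r (k + n)) < e"
      using suminf_exist_split[OF \<open>0 < e\<close>] by blast
    have "(\<Sum>k. \<mu> (R (k + n))) = ennreal (\<Sum>k. r (k + n))"
      unfolding r(1) using \<open>summable r\<close> r(2) by (intro suminf_ennreal2) (auto simp: summable_iff_shift)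
    also have "\<dots> \<le> ennreal e"
      using n by (intro ennreal_leI) auto
    finally have tail: "(\<Sum>k. \<mu> (R (k + n))) \<le> ennreal e" .
    have disj: "disjoint_family (\<lambda>k. R (k + n))"
    proof -
      have "R i \<inter> R j = {}" if "i < j" for i j
        using power_decreasing[of "Suc i" j "1/2 :: real"] that by (fastforce simp: R_def)
      then show ?thesis
        unfolding disjoint_family_on_def by (metis add_right_cancel linorder_neqE_nat inf_commute)
    qed
    have "A - F \<subseteq> T n \<union> (\<Union>k. R (k + n))"
    proof
      fix x assume x: "x \<in> A - F"
      then have "0 < d x"
        using F_iff[of x] d_nonneg[of x] by auto
      then have ex: "\<exists>m. (1/2) ^ m \<le> d x"
        using real_arch_pow_inv[of "d x" "1/2"] by (auto intro: less_imp_le)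
      \<comment> \<open>The first dyadic level reached by \<open>d x\<close>. If it exceeds
        \<open>n\<close>, the preceding level \<open>m - 1\<close> is not reached, which puts
        \<open>x\<close> in the ring of index \<open>m - 1 = k + n\<close>.\<close>
      define m where "m = (LEAST m. (1/2) ^ m \<le> d x)"
      have m: "(1/2) ^ m \<le> d x"
        unfolding m_def by (rule LeastI_ex[OF ex])
      show "x \<in> T n \<union> (\<Union>k. R (k + n))"
      proof (cases "(1/2) ^ n \<le> d x")
        case True
        then show ?thesis using x by (simp add: T_def)
      next
        case False
        have "n < m"
        proof (rule ccontr)
          assume "\<not> n < m"
          then have "(1/2) ^ n \<le> ((1/2) ^ m :: real)"
            by (intro power_decreasing) auto
          with m False show False by linarith
        qed
        then obtain k where k: "m = Suc (k + n)"
          using less_imp_Suc_add by (metis add.commute)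
        have "d x < (1/2) ^ (k + n)"
          using not_less_Least[of "k + n" "\<lambda>m. (1/2) ^ m \<le> d x"] k by (simp add: m_def)
        then have "x \<in> R (k + n)"
          using m k x by (simp add: R_def)
        then show ?thesis by blast
      qed
    qed
    then have "\<mu> (A - F) \<le> \<mu> (T n \<union> (\<Union>k. R (k + n)))"
      by (rule mono)
    also have "\<dots> \<le> \<mu> (T n) + \<mu> (\<Union>k. R (k + n))"
    proof (rule sub)
      have "T n \<inter> R (k + n) = {}" for k
        using power_decreasing[of n "k + n" "1/2 :: real"] by (fastforce simp: T_def R_def)
      then show "T n \<inter> (\<Union>k. R (k + n)) = {}"
        by blast
    qed
    also have "\<dots> \<le> \<mu> (T n) + ennreal e"
      using order_trans[OF csub[OF disj] tail] by (rule add_left_mono)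
    finally have "\<mu> (A \<inter> F) + \<mu> (A - F) \<le> (\<mu> (A \<inter> F) + \<mu> (T n)) + ennreal e"
      by (simp add: add.assoc add_left_mono)
    \<comment> \<open>Points of \<open>F\<close> have \<open>d = 0\<close> and points of
      \<open>T n\<close> have \<open>d\<close> at least \<open>(1/2) ^ n\<close>, so the Lipschitz
      bound separates the two sets.\<close>
    also have "\<mu> (A \<inter> F) + \<mu> (T n) \<le> \<mu> ((A \<inter> F) \<union> T n)"
    proof (rule metric[where \<epsilon> = "(1/2) ^ n"])
      fix x y assume "x \<in> A \<inter> F" "y \<in> T n"
      then show "(1/2) ^ n \<le> dist x y"
        using F_iff[of x] d_lipschitz[of y x] by (simp add: T_def dist_commute)
    qed simp
    also have "\<dots> \<le> \<mu> A"
      by (rule mono) (auto simp: T_def)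
    finally show "\<mu> (A \<inter> F) + \<mu> (A - F) \<le> \<mu> A + ennreal e"
      by (simp add: add_right_mono)
  qed
  moreover have "\<mu> A \<le> \<mu> (A \<inter> F) + \<mu> (A - F)" for A
    using sub[of "A \<inter> F" "A - F"] by (simp add: Int_Diff_Un Int_Diff disjoint_iff)
  ultimately show ?thesis
    by (auto simp: lambda_system_def Int_commute Diff_eq intro!: antisym)
qed

text \<open>The Caratheodory-measurable sets form a sigma-algebra containing all closed sets, hence
  all Borel sets, and the measure restricts to the latter.\<close>

lemma measure_space_borel_metric_outer:
  fixes \<mu> :: "'a::metric_space set \<Rightarrow> ennreal"
  assumes outer: "outer_measure_space UNIV \<mu>"
    and metric: "\<And>A B \<epsilon>. 0 < \<epsilon> \<Longrightarrow> (\<And>x y. x \<in> A \<Longrightarrow> y \<in> B \<Longrightarrow> \<epsilon> \<le> dist x y) \<Longrightarrow> \<mu> A + \<mu> B \<le> \<mu> (A \<union> B)"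
  shows "measure_space UNIV (sets borel) \<mu>"
proof -
  have ms: "measure_space UNIV (lambda_system UNIV UNIV \<mu>) \<mu>"
    using sigma_algebra.caratheodory_lemma[OF sigma_algebra_Pow[of UNIV], of \<mu>] outer by simp
  then interpret L: sigma_algebra UNIV "lambda_system UNIV UNIV \<mu>"
    by (simp add: measure_space_def)
  have "sets (borel :: 'a measure) \<subseteq> lambda_system UNIV UNIV \<mu>"
    unfolding borel_eq_closed sets_measure_of[OF subset_UNIV[of "Collect closed", folded Pow_UNIV]]
    by (intro L.sigma_sets_subset) (auto intro: closed_in_lambda_system[OF outer metric])
  then show ?thesis
    using ms sets.sigma_algebra_axioms[of "borel :: 'a measure"]
    by (intro measure_down[OF ms]) simp_all
qed

section \<open>The Hausdorff measure on Borel sets\<close>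

lemma sets_hausdorff1 [simp, measurable_cong]: "sets hausdorff1 = sets borel"
  unfolding hausdorff1_def using sets.sigma_sets_eq[of borel] by (simp add: sets_measure_of_conv)

lemma space_hausdorff1 [simp]: "space hausdorff1 = UNIV"
  unfolding hausdorff1_def by (simp add: space_measure_of_conv)

text \<open>\<open>measure_of\<close> yields the zero measure unless its argument is a measure on
  the generated sigma-algebra; the Caratheodory argument excludes this.\<close>

lemma emeasure_hausdorff1:
  assumes "A \<in> sets borel"
  shows "emeasure hausdorff1 A = hausdorff1_outer A"
proof (rule emeasure_measure_of[OF hausdorff1_def])
  have "measure_space UNIV (sets borel) (hausdorff1_outer :: 'a set \<Rightarrow> ennreal)"
    by (intro measure_space_borel_metric_outer outer_measure_space_hausdorff1_outer
        hausdorff1_outer_Un_separated)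
  then show "positive (sets hausdorff1) (hausdorff1_outer :: 'a set \<Rightarrow> ennreal)"
    "countably_additive (sets hausdorff1) (hausdorff1_outer :: 'a set \<Rightarrow> ennreal)"
    by (auto simp: measure_space_def)
qed (use assms in auto)

section \<open>Comparison with Lebesgue measure along an isometry\<close>

text \<open>For every mesh the interval is cut into \<open>n\<close> equal pieces of length at most
  \<delta>. Their images keep their diameters, which add up to at most \<open>u - l\<close>.\<close>

lemma hausdorff1_outer_isometry_interval_le:
  fixes g :: "real \<Rightarrow> 'a::metric_space"
  assumes g: "\<And>s t. dist (g s) (g t) = dist s t" and "l \<le> u"
  shows "hausdorff1_outer (g ` {l..u}) \<le> ennreal (u - l)"
  unfolding hausdorff1_outer_def
proof (rule SUP_least)
  fix \<delta> :: real assume "\<delta> \<in> {0<..}"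
  then have "0 < \<delta>" by simp
  obtain n :: nat where n: "(u - l) / \<delta> < n" 
    using reals_Archimedean2 by blast
  have "0 < n"
    using n \<open>0 < \<delta>\<close> \<open>l \<le> u\<close> by (cases n) (auto simp: field_simps)
  define h where "h = (u - l) / n"
  have h: "0 \<le> h" "h \<le> \<delta>" "n * h = u - l"
    using n \<open>0 < n\<close> \<open>0 < \<delta>\<close> \<open>l \<le> u\<close> by (auto simp: h_def field_simps)
  \<comment> \<open>Empty sets of diameter 0 extend the finite cover to a sequence.\<close>
  define C where "C i = (if i < n then g ` {l + i * h..l + i * h + h} else {})" for i :: nat
  have dist_C: "dist x y \<le> h" if "x \<in> C i" "y \<in> C i" for x y i
    using that by (auto simp: C_def g dist_real_def split: if_splits)
  have diam: "diameter (C i) \<le> h" for i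
    unfolding diameter_def using dist_C h(1) by (auto intro!: cSUP_least)
  have bdd: "bounded (C i)" for i
    using dist_C unfolding bounded_two_points by blast
  have "g ` {l..u} \<subseteq> (\<Union>i. C i)"
  proof clarify
    fix t assume t: "t \<in> {l..u}"
    show "g t \<in> (\<Union>i. C i)"
    proof (cases "t < u")
      case True
      then have "0 < h" using h t \<open>0 < n\<close> by (auto simp: h_def)
      define i where "i = nat \<lfloor>(t - l) / h\<rfloor>"
      have i: "real i = of_int \<lfloor>(t - l) / h\<rfloor>" using t \<open>0 < h\<close> by (simp add: i_def)
      have lo: "i \<le> (t - l) / h" and up: "(t - l) / h < real i + 1"
        unfolding i by linarith+
      have a: "i * h \<le> t - l" "t - l \<le> i * h + h"
        using lo up \<open>0 < h\<close> by (auto simp: field_simps)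
      have "i * h < n * h" using a True h by auto
      then have "i < n" using \<open>0 < h\<close> by simp
      with a show ?thesis by (auto simp: C_def intro!: exI[of _ i])
    next
      \<comment> \<open>For \<open>h > 0\<close> the floor formula would give the endpoint the index
        \<open>n\<close>, one too large, so it is placed in the last closed piece. This case also
        covers \<open>l = u\<close>, where \<open>h = 0\<close>.\<close>
      case False
      then have "t = u" using t by simp
      have "l + real (n - 1) * h + h = u" using \<open>0 < n\<close> h(3) by (simp add: of_nat_diff algebra_simps)
      then show ?thesis using \<open>0 < n\<close> h(1) \<open>t = u\<close>
        by (auto simp: C_def intro!: exI[of _ "n - 1"])
    qed
  qed
  then have "hausdorff1_pre \<delta> (g ` {l..u}) \<le> (\<Sum>i. ennreal (diameter (C i)))"
    by (intro hausdorff1_pre_le bdd order_trans[OF diam h(2)])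
  also have "\<dots> = (\<Sum>i<n. ennreal (diameter (C i)))"
    by (rule suminf_finite) (auto simp: C_def)
  also have "\<dots> \<le> (\<Sum>i<n. ennreal h)"
    by (intro sum_mono ennreal_leI diam)
  also have "\<dots> = ennreal (u - l)"
    using h by (simp add: ennreal_of_nat_eq_real_of_nat ennreal_mult[symmetric])
  finally show "hausdorff1_pre \<delta> (g ` {l..u}) \<le> ennreal (u - l)" .
qed

text \<open>On the real line the hull from \<open>Inf P\<close> to \<open>Sup P\<close> has the
  diameter of \<open>P\<close> as its length. This turns arbitrary covers into covers by
  intervals.\<close>

lemma bounded_subset_interval_diameter:
  fixes P :: "real set"
  assumes "bounded P"
  obtains a b where "a \<le> b" "P \<subseteq> {a..b}" "b - a \<le> diameter P"
proof (cases "P = {}")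
  case True
  then show ?thesis using that[of 0 0] by simp
next
  case False
  have bdd: "bdd_above P" "bdd_below P"
    using assms by (auto intro: bounded_imp_bdd_above bounded_imp_bdd_below)
  have "x \<le> Inf P + diameter P" if "x \<in> P" for x
  proof -
    have "x - diameter P \<le> Inf P"
    proof (rule cInf_greatest[OF False])
      fix y assume "y \<in> P"
      then show "x - diameter P \<le> y"
        using diameter_bounded_bound[OF assms \<open>x \<in> P\<close>, of y] by (auto simp: dist_real_def)
    qed
    then show ?thesis by simp
  qed
  then have "Sup P \<le> Inf P + diameter P"
    by (rule cSup_least[OF False])
  moreover have "P \<subseteq> {Inf P..Sup P}"
    using bdd by (auto intro: cInf_lower cSup_upper)
  moreover have "Inf P \<le> Sup P"
    using False bdd by (rule cInf_le_cSup)
  ultimately show ?thesis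
    using that[of "Inf P" "Sup P"] by simp
qed

text \<open>A cover of the image pulls back along \<open>g\<close> without increasing diameters.
  Enclosing the preimages in intervals of no greater length reduces the bound to countable
  subadditivity of Lebesgue measure.\<close>

lemma hausdorff1_outer_isometry_ge:
  fixes g :: "real \<Rightarrow> 'a::metric_space"
  assumes g: "\<And>s t. dist (g s) (g t) = dist s t" and S: "S \<in> sets borel"
  shows "emeasure lborel S \<le> hausdorff1_outer (g ` S)"
proof -
  \<comment> \<open>The mesh 1 is an arbitrary positive choice, since the supremum dominates every
    premeasure.\<close>
  have "emeasure lborel S \<le> hausdorff1_pre 1 (g ` S)"
    unfolding hausdorff1_pre_def
  proof (rule INF_greatest, clarify)
    fix C :: "nat \<Rightarrow> 'a set"
    assume cover: "g ` S \<subseteq> (\<Union>i. C i)" and "\<forall>i. bounded (C i) \<and> diameter (C i) \<le> 1"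
    then have bdd: "bounded (C i)" for i by auto
    have dist_le: "dist s t \<le> diameter (C i)" if "s \<in> g -` C i" "t \<in> g -` C i" for i s t
      using that diameter_bounded_bound[OF bdd] g by fastforce
    have bddP: "bounded (g -` C i)" for i
      using dist_le unfolding bounded_two_points by blast
    have diamP: "diameter (g -` C i) \<le> diameter (C i)" for i
      using dist_le diameter_ge_0[OF bdd] by (intro diameter_le) (auto simp: dist_norm)
    have "\<exists>a b. a \<le> b \<and> g -` C i \<subseteq> {a..b} \<and> b - a \<le> diameter (C i)" for i
    proof -
      obtain a b where "a \<le> b" "g -` C i \<subseteq> {a..b}" "b - a \<le> diameter (g -` C i)"
        using bounded_subset_interval_diameter[OF bddP] .
      then show ?thesis
        using diamP[of i] by (intro exI[of _ a] exI[of _ b]) auto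
    qed
    then obtain a b where ab: "\<And>i. a i \<le> b i" "\<And>i. g -` C i \<subseteq> {a i..b i}"
      "\<And>i. b i - a i \<le> diameter (C i)"
      by metis
    have "S \<subseteq> (\<Union>i. g -` C i)"
      using cover by (auto simp: subset_eq)
    also have "\<dots> \<subseteq> (\<Union>i. {a i..b i})"
      by (intro UN_mono ab(2)) auto
    finally have "emeasure lborel S \<le> emeasure lborel (\<Union>i. {a i..b i})"
      by (intro emeasure_mono) auto
    also have "\<dots> \<le> (\<Sum>i. emeasure lborel {a i..b i})"
      by (intro emeasure_subadditive_countably) auto
    also have "\<dots> \<le> (\<Sum>i. ennreal (diameter (C i)))"
      using ab by (intro suminf_le) (auto intro!: ennreal_leI)
    finally show "emeasure lborel S \<le> (\<Sum>i. ennreal (diameter (C i)))" .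
  qed
  also have "\<dots> \<le> hausdorff1_outer (g ` S)"
    by (rule hausdorff1_pre_le_outer) simp
  finally show ?thesis .
qed

section \<open>The integral that defines the constant\<close>

lemma integrable_inverse_1_plus_powr:
  fixes \<beta> :: real
  assumes "2 \<le> \<beta>"
  shows "integrable lborel (\<lambda>t::real. 1 / (1 + \<bar>t\<bar> powr \<beta>))"
proof -
  have "integrable lborel (\<lambda>t::real. 2 * inverse (1 + t\<^sup>2))"
    using integrable_inverse_1_plus_square by (simp add: set_integrable_def)
  then show ?thesis
  proof (rule Bochner_Integration.integrable_bound)
    have "1 / (1 + \<bar>t\<bar> powr \<beta>) \<le> 2 * inverse (1 + t\<^sup>2)" for t :: real
    proof -
      \<comment> \<open>This is the comparison with \<open>2 / (1 + t\<^sup>2)\<close> after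
        clearing denominators.\<close>
      have "t\<^sup>2 \<le> 1 + 2 * \<bar>t\<bar> powr \<beta>"
      proof (cases "\<bar>t\<bar> \<le> 1")
        case True
        then have "t\<^sup>2 \<le> 1" using abs_square_le_1 by blast
        then show ?thesis using powr_ge_zero[of "\<bar>t\<bar>" \<beta>] by linarith
      next
        case False
        then have "\<bar>t\<bar> powr 2 \<le> \<bar>t\<bar> powr \<beta>" using assms by (intro powr_mono) auto
        moreover have "\<bar>t\<bar> powr 2 = t\<^sup>2" using False by (simp add: powr_numeral)
        ultimately show ?thesis using powr_ge_zero[of "\<bar>t\<bar>" \<beta>] by linarith
      qed
      moreover have "0 < 1 + \<bar>t\<bar> powr \<beta>" "0 < 1 + t\<^sup>2"
        by (auto intro: add_pos_nonneg)
      ultimately show ?thesis by (simp add: field_simps)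
    qed
    then show "AE t in lborel. norm (1 / (1 + \<bar>t\<bar> powr \<beta>)) \<le> norm (2 * inverse (1 + t\<^sup>2))"
      by (intro AE_I2) (simp add: abs_of_nonneg add_nonneg_nonneg)
  qed measurable
qed

lemma LBINT_even:
  fixes f :: "real \<Rightarrow> real"
  assumes "integrable lborel f" "\<And>t. f (- t) = f t"
  shows "(LINT t|lborel. f t) = 2 * (LINT t:{0..}|lborel. f t)"
proof -
  have i: "set_integrable lborel A f" if "A \<in> sets borel" for A
    using assms(1) that by (auto simp: set_integrable_def simp del: real_scaleR_def intro!: integrable_mult_indicator)
  have "(LINT t|lborel. f t) = (LINT t:{0..} \<union> {..<0}|lborel. f t)"
    by (auto simp: set_lebesgue_integral_def indicator_def intro!: Bochner_Integration.integral_cong)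
  also have "\<dots> = (LINT t:{0..}|lborel. f t) + (LINT t:{..<0}|lborel. f t)"
    by (intro set_integral_Un i) auto
  also have "(LINT t:{..<0}|lborel. f t) = (LINT t:{0<..}|lborel. f t)"
    by (subst set_integral_reflect) (simp add: assms(2) greaterThan_def)
  also have "\<dots> = (LINT t:{0..}|lborel. f t)"
    unfolding set_lebesgue_integral_def
    using AE_lborel_singleton[of 0]
    by (intro integral_cong_AE) (use assms(1) in \<open>auto simp: indicator_def borel_measurable_integrable\<close>)
  finally show ?thesis by simp
qed

text \<open>Substituting \<open>c * t\<close> for \<open>t\<close> produces the factor
  \<open>1 / c\<close>, and evenness of the integrand the factor 2.\<close>

lemma LBINT_inverse_1_plus_powr:
  fixes \<beta> c :: real
  assumes "2 \<le> \<beta>" "0 < c"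
  shows "(LINT t|lborel. 1 / (1 + (\<bar>t\<bar> * c) powr \<beta>)) = 2 / c * (LINT t:{0..}|lborel. 1 / (1 + t powr \<beta>))"
proof -
  have "(LINT t|lborel. 1 / (1 + \<bar>t\<bar> powr \<beta>)) = c * (LINT t|lborel. 1 / (1 + (\<bar>t\<bar> * c) powr \<beta>))"
    using \<open>0 < c\<close> by (subst lborel_integral_real_affine[where c=c and t=0]) (auto simp: abs_mult mult.commute)
  moreover have "(LINT t|lborel. 1 / (1 + \<bar>t\<bar> powr \<beta>)) = 2 * (LINT t:{0..}|lborel. 1 / (1 + \<bar>t\<bar> powr \<beta>))"
    by (rule LBINT_even[OF integrable_inverse_1_plus_powr[OF assms(1)]]) simp
  moreover have "(LINT t:{0..}|lborel. 1 / (1 + \<bar>t\<bar> powr \<beta>)) = (LINT t:{0..}|lborel. 1 / (1 + t powr \<beta>))"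
    by (rule set_lebesgue_integral_cong) auto
  ultimately show ?thesis using \<open>0 < c\<close> by (simp add: field_simps)
qed

text \<open>An integrable function that is positive everywhere has nonzero integral, because
  \<open>lborel\<close> is not the zero measure. Integrability matters: the integral would otherwise
  default to 0, and so would its inverse.\<close>

lemma lambda_const_pos:
  assumes "0 \<le> \<alpha>"
  shows "0 < lambda_const \<alpha>"
proof -
  let ?f = "\<lambda>t::real. 1 / (1 + \<bar>t\<bar> powr (2 + \<alpha>))"
  have pos: "0 < ?f t" for t by (auto intro: add_pos_nonneg)
  have int: "integrable lborel ?f"
    using assms by (intro integrable_inverse_1_plus_powr) auto
  have "(LINT t|lborel. ?f t) \<noteq> 0"
  proof
    assume "(LINT t|lborel. ?f t) = 0"
    then have "AE t in lborel. ?f t = 0"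
      using integral_nonneg_eq_0_iff_AE[OF int] pos by (auto intro: less_imp_le)
    then have "AE t::real in lborel. False"
      by eventually_elim (use pos in \<open>auto simp: less_le\<close>)
    then show False by (simp add: eventually_False ae_filter_eq_bot_iff)
  qed
  moreover have "0 \<le> (LINT t|lborel. ?f t)"
    using pos by (intro integral_nonneg_AE AE_I2) (auto intro: less_imp_le)
  moreover have "(LINT t|lborel. ?f t) = 2 * (LINT t:{0..}|lborel. 1 / (1 + t powr (2 + \<alpha>)))"
    using LBINT_inverse_1_plus_powr[of "2 + \<alpha>" 1] assms by simp
  ultimately show ?thesis by (simp add: lambda_const_def)
qed

section \<open>Integration over a line against the Hausdorff measure\<close>

lemma hausdorff1_outer_isometry_interval:
  fixes g :: "real \<Rightarrow> 'a::metric_space"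
  assumes g: "\<And>s t. dist (g s) (g t) = dist s t" and "l \<le> u"
  shows "hausdorff1_outer (g ` {l<..<u}) = ennreal (u - l)"
proof (rule antisym)
  have "hausdorff1_outer (g ` {l<..<u}) \<le> hausdorff1_outer (g ` {l..u})"
    by (intro hausdorff1_outer_mono image_mono) auto
  also have "\<dots> \<le> ennreal (u - l)"
    by (rule hausdorff1_outer_isometry_interval_le[OF assms])
  finally show "hausdorff1_outer (g ` {l<..<u}) \<le> ennreal (u - l)" .
  show "ennreal (u - l) \<le> hausdorff1_outer (g ` {l<..<u})"
    using hausdorff1_outer_isometry_ge[OF g, of "{l<..<u}"] \<open>l \<le> u\<close> by simp
qed

lemma range_scaleR_borel: "range (\<lambda>t. t *\<^sub>R (e :: 'a::euclidean_space)) \<in> sets borel"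
  using closed_subspace[OF subspace_span[of "{e}"]] by (simp add: span_singleton borel_closed)

text \<open>On the line the coordinate \<open>x \<bullet> e\<close> inverts
  \<open>t *\<^sub>R e\<close>, an isometry because \<open>e\<close> is a unit vector. Lebesgue
  measure is determined by its values on open intervals, and these agree.\<close>

lemma distr_hausdorff1_line:
  fixes e :: "'a::euclidean_space"
  assumes "norm e = 1"
  shows "distr (restrict_space hausdorff1 (range (\<lambda>t. t *\<^sub>R e))) borel (\<lambda>x. x \<bullet> e) = lborel"
    (is "distr (restrict_space _ ?L) _ _ = _")
proof (rule lborel_eqI[symmetric])
  have [simp]: "e \<bullet> e = 1"
    using assms by (simp add: norm_eq_1)
  note range_scaleR_borel[measurable]
  fix l u :: real assume "\<And>b. b \<in> Basis \<Longrightarrow> l \<bullet> b \<le> u \<bullet> b"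
  then have "l \<le> u" by simp
  let ?I = "(\<lambda>t. t *\<^sub>R e) ` {l<..<u}"
  have "emeasure (distr (restrict_space hausdorff1 ?L) borel (\<lambda>x. x \<bullet> e)) (box l u)
      = emeasure (restrict_space hausdorff1 ?L) ((\<lambda>x. x \<bullet> e) -` box l u \<inter> ?L)"
    by (subst emeasure_distr) (auto simp: space_restrict_space intro!: measurable_restrict_space1)
  also have "(\<lambda>x. x \<bullet> e) -` box l u \<inter> ?L = ?I"
    by (auto simp: box_real)
  also have "emeasure (restrict_space hausdorff1 ?L) ?I = emeasure hausdorff1 ?I"
    by (rule emeasure_restrict_space) auto
  also have "\<dots> = hausdorff1_outer ?I"
  proof (rule emeasure_hausdorff1)
    have "?I = ?L \<inter> {x. l < x \<bullet> e} \<inter> {x. x \<bullet> e < u}"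
      by auto
    then show "?I \<in> sets borel"
      by simp
  qed
  also have "\<dots> = ennreal (u - l)"
    using assms \<open>l \<le> u\<close>
    by (intro hausdorff1_outer_isometry_interval) (simp_all add: dist_norm flip: scaleR_left_diff_distrib)
  finally show "emeasure (distr (restrict_space hausdorff1 ?L) borel (\<lambda>x. x \<bullet> e)) (box l u)
      = ennreal (\<Prod>b\<in>Basis. (u - l) \<bullet> b)"
    by simp
qed simp

lemma set_integral_hausdorff1_line:
  fixes e :: "'a::euclidean_space" and f :: "'a \<Rightarrow> real"
  assumes "norm e = 1" and [measurable]: "(\<lambda>t. f (t *\<^sub>R e)) \<in> borel_measurable borel"
  shows "(LINT x:range (\<lambda>t. t *\<^sub>R e)|hausdorff1. f x) = (LINT t|lborel. f (t *\<^sub>R e))"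
    (is "(LINT x:?L|_. _) = _")
proof -
  have [simp]: "e \<bullet> e = 1"
    using assms by (simp add: norm_eq_1)
  have L: "?L \<in> sets borel"
    by (rule range_scaleR_borel)
  have "(LINT t|lborel. f (t *\<^sub>R e))
      = (LINT t|distr (restrict_space hausdorff1 ?L) borel (\<lambda>x. x \<bullet> e). f (t *\<^sub>R e))"
    using distr_hausdorff1_line[OF assms(1)] by simp
  \<comment> \<open>The integrand is written through the coordinate \<open>x \<bullet> e\<close>, so
    measurability of \<open>f\<close> along the line suffices; on the line
    \<open>(x \<bullet> e) *\<^sub>R e\<close> is \<open>x\<close> itself.\<close>
  also have "\<dots> = (LINT x|restrict_space hausdorff1 ?L. f ((x \<bullet> e) *\<^sub>R e))"
    by (intro integral_distr measurable_restrict_space1) auto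
  also have "\<dots> = (LINT x:?L|hausdorff1. f ((x \<bullet> e) *\<^sub>R e))"
    unfolding set_lebesgue_integral_def using L by (intro integral_restrict_space) auto
  also have "\<dots> = (LINT x:?L|hausdorff1. f x)"
    using L by (intro set_lebesgue_integral_cong) auto
  finally show ?thesis by simp
qed

section \<open>The planar formula\<close>

lemma orthogonal_line_plane:
  fixes p :: "real^2"
  assumes "p \<noteq> 0"
  shows "{x. x \<bullet> p = 0} = range (\<lambda>t. t *\<^sub>R ((1 / norm p) *\<^sub>R vector [- p $ 2, p $ 1]))"
proof (intro set_eqI iffI)
  fix x :: "real^2" assume "x \<in> {x. x \<bullet> p = 0}"
  then have x: "x $ 1 * p $ 1 = - (x $ 2 * p $ 2)"
    by (simp add: inner_vec_def sum_2)
  have n: "norm p * norm p = p $ 1 * p $ 1 + p $ 2 * p $ 2"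
    using power2_norm_eq_inner[of p] by (simp add: inner_vec_def sum_2 power2_eq_square)
  show "x \<in> range (\<lambda>t. t *\<^sub>R ((1 / norm p) *\<^sub>R vector [- p $ 2, p $ 1]))"
  proof (rule image_eqI)
    have "norm p * norm p * x $ 1 = - (x $ 2 * p $ 1 - x $ 1 * p $ 2) * p $ 2"
      unfolding n using x by algebra
    moreover have "norm p * norm p * x $ 2 = (x $ 2 * p $ 1 - x $ 1 * p $ 2) * p $ 1"
      unfolding n using x by algebra
    \<comment> \<open>The witness is the inner product of \<open>x\<close> with the unit vector that
      spans the line.\<close>
    ultimately show "x = ((x $ 2 * p $ 1 - x $ 1 * p $ 2) / norm p) *\<^sub>R ((1 / norm p) *\<^sub>R vector [- p $ 2, p $ 1])"
      using assms by (simp add: vec_eq_iff forall_2 field_simps)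
  qed simp
qed (auto simp: inner_vec_def sum_2)

theorem proposition3p10:
  fixes \<alpha> :: real and N :: "real^2 \<Rightarrow> real"
  assumes "0 < \<alpha>" and "\<alpha> < 2"
    and "is_norm N"
  shows "lambda_const \<alpha> > 0 \<and>
         (\<forall>p1 p2. Phi \<alpha> N (vector [p1, p2]) = lambda_const \<alpha> / 4 * N (vector [- p2, p1]))"
proof (intro conjI allI)
  show "lambda_const \<alpha> > 0"
    using assms(1) by (intro lambda_const_pos) simp
  fix p1 p2 :: real
  define p q :: "real^2" where "p = vector [p1, p2]" and "q = vector [- p2, p1]"
  have N: "N 0 = 0" "\<And>x. x \<noteq> 0 \<Longrightarrow> 0 < N x" "\<And>c x. N (c *\<^sub>R x) = \<bar>c\<bar> * N x"
    using assms(3) by (auto simp: is_norm_def less_le)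
  show "Phi \<alpha> N (vector [p1, p2]) = lambda_const \<alpha> / 4 * N (vector [- p2, p1])"
  \<comment> \<open>The origin is separate because \<open>Phi\<close> is set to 0 there;
    \<open>q\<close> vanishes with \<open>p\<close>, so both sides are 0.\<close>
  proof (cases "p = 0")
    case True
    then have "q = 0"
      by (simp add: p_def q_def vec_eq_iff forall_2)
    with True show ?thesis
      by (simp add: Phi_def N flip: p_def q_def)
  next
    case False
    define e where "e = (1 / norm p) *\<^sub>R q"
    have "norm q = norm p"
      by (simp add: p_def q_def norm_vec_def L2_set_def sum_2 add.commute)
    then have e: "norm e = 1" and "q \<noteq> 0"
      using False by (auto simp: e_def)
    have c: "N e = N q / norm p" "0 < N e"
      using N False \<open>q \<noteq> 0\<close> by (auto simp: e_def)
    have "{x. x \<bullet> p = 0} = range (\<lambda>t. t *\<^sub>R e)"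
      using orthogonal_line_plane[OF False] by (simp add: e_def q_def p_def)
    then have "(LINT x:{x. x \<bullet> p = 0}|hausdorff1. 1 / (1 + N x powr (2 + \<alpha>)))
        = (LINT t|lborel. 1 / (1 + (\<bar>t\<bar> * N e) powr (2 + \<alpha>)))"
      using e by (simp add: set_integral_hausdorff1_line N(3))
    also have "\<dots> = 2 / N e * inverse (lambda_const \<alpha>)"
      using LBINT_inverse_1_plus_powr[of "2 + \<alpha>" "N e"] assms(1) c(2) by (simp add: lambda_const_def)
    \<comment> \<open>One factor 2 comes from the definition of \<open>Phi\<close>, another from the
      two half-lines; inverting their product gives \<open>1 / 4\<close>. By homogeneity
      \<open>N e * norm p\<close> is \<open>N q\<close>.\<close>
    finally have "Phi \<alpha> N p = lambda_const \<alpha> / 4 * (N e * norm p)"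
      using False by (simp add: Phi_def field_simps)
    then show ?thesis
      using c(1) False by (simp flip: p_def q_def)
  qed
qed

end
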